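(* There is no Carmichael number $m$ with exactly three prime factors such that $s_p(m)\ne p$ for every prime divisor $p$ of $m$. That is, $\mathcal{C}^\sharp_3=\emptyset$.
   Context: For a prime $p$ and integer $m\ge0$, $s_p(m)$ denotes the sum of the base-$p$ digits of $m$. A Carmichael number is a composite positive integer $m$ with $a^{m-1}\equiv1\pmod m$ for all integers $a$ coprime to $m$. $\mathcal{C}^\sharp$ (exceptional Carmichael numbers) is the set of Carmichael numbers $m$ with $s_p(m)\ne p$ for every prime $p\mid m$, and $\mathcal{C}^\sharp_3$ is the subset of those having exactly three prime factors. *)

theory Defs
  imports "HOL-Number_Theory.Number_Theory"
begin

(* For b >= 2 the digits at positions i > n vanish, as b ^ i > i > n there; hence the
   range i <= n covers all digits (see digit_sum_expansion). Not meant for b < 2. *)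
definition digit_sum :: "nat \<Rightarrow> nat \<Rightarrow> nat" where
  "digit_sum b n = (\<Sum>i\<le>n. n div b ^ i mod b)"

definition carmichael_number :: "nat \<Rightarrow> bool" where
  "carmichael_number m \<longleftrightarrow>
     m > 1 \<and> \<not> prime m \<and> (\<forall>a::int. coprime a (int m) \<longrightarrow> [a ^ (m - 1) = 1] (mod int m))"

definition exceptional_carmichael :: "nat set" where
  "exceptional_carmichael =
     {m. carmichael_number m \<and> (\<forall>p. prime p \<and> p dvd m \<longrightarrow> digit_sum p m \<noteq> p)}"

(* Distinct primes are counted; Carmichael numbers are squarefree, so counting with
   multiplicity gives the same set. *)
definition exceptional_carmichael3 :: "nat set" where
  "exceptional_carmichael3 = {m \<in> exceptional_carmichael. card (prime_factors m) = 3}"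

lemma digit_of_expansion:
  fixes b :: nat
  assumes "\<And>i. i < k \<Longrightarrow> d i < b" and "b \<ge> 2"
  shows "(\<Sum>i<k. d i * b ^ i) div b ^ j mod b = (if j < k then d j else 0)"
  using assms(1)
proof (induction k arbitrary: d j)
  case 0
  then show ?case by simp
next
  case (Suc k)
  have eq: "(\<Sum>i<Suc k. d i * b ^ i) = d 0 + b * (\<Sum>i<k. d (Suc i) * b ^ i)"
    by (simp add: sum.lessThan_Suc_shift sum_distrib_left mult_ac del: sum.lessThan_Suc)
  have d0: "d 0 < b" using Suc.prems by simp
  show ?case
  proof (cases j)
    case 0
    then show ?thesis using d0 by (simp add: eq del: sum.lessThan_Suc)
  next
    case (Suc j')
    have "(\<Sum>i<Suc k. d i * b ^ i) div b ^ j = (\<Sum>i<k. d (Suc i) * b ^ i) div b ^ j'"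
      using d0 assms(2)
      by (simp add: eq Suc div_mult2_eq del: sum.lessThan_Suc)
    then show ?thesis
      using Suc.IH[of "\<lambda>i. d (Suc i)" j'] Suc.prems Suc by simp
  qed
qed

lemma digit_sum_expansion:
  fixes b :: nat
  assumes "\<And>i. i < k \<Longrightarrow> d i < b" and "b \<ge> 2"
  shows "digit_sum b (\<Sum>i<k. d i * b ^ i) = (\<Sum>i<k. d i)"
proof -
  define n where "n = (\<Sum>i<k. d i * b ^ i)"
  have dig: "n div b ^ j mod b = (if j < k then d j else 0)" for j
    unfolding n_def using assms by (rule digit_of_expansion)
  have zero: "n div b ^ j mod b = 0" if "j > n" for j
  proof -
    have "j < b ^ j" using assms(2) by (intro less_exp[THEN less_le_trans] power_mono) auto
    then show ?thesis using that by simp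
  qed
  have "digit_sum b n = (\<Sum>i\<le>max n k. n div b ^ i mod b)"
    unfolding digit_sum_def by (intro sum.mono_neutral_left ballI zero) auto
  also have "\<dots> = (\<Sum>i<k. n div b ^ i mod b)"
    by (rule sum.mono_neutral_right) (auto simp: dig)
  also have "\<dots> = (\<Sum>i<k. d i)" by (simp add: dig)
  finally show ?thesis unfolding n_def .
qed

end

theory Submission
  imports Defs
begin

text \<open>
  The largest prime factor \<open>r\<close> of \<open>m\<close> always satisfies \<open>s\<^sub>r(m) = r\<close>. Writing \<open>m = r n\<close>, where \<open>n\<close>
  is a product of two primes below \<open>r\<close>, we have \<open>n < r\<^sup>2\<close>, so \<open>n = a + b r\<close> has just two digits and
  \<open>s\<^sub>r(m) = a + b\<close>. Korselt's criterion gives \<open>n \<equiv> 1 (mod r - 1)\<close>, hence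
  \<open>a + b \<equiv> 1 (mod r - 1)\<close> with \<open>1 \<le> a + b \<le> 2 (r - 1)\<close>; as \<open>a + b = 1\<close> would force
  \<open>n \<in> {1, r}\<close>, only \<open>a + b = r\<close> remains.
\<close>

text \<open>The exponent of the unit group mod \<open>m\<close> is attained as the order of a single
  element \<open>g\<close>, so applying the hypothesis to \<open>g\<close> alone suffices.\<close>

lemma carmichael_number_Carmichael_dvd:
  assumes "carmichael_number m"
  shows "Carmichael m dvd m - 1"
proof -
  from assms have "m > 1" by (simp add: carmichael_number_def)
  then obtain g where g: "g \<in> totatives m" "ord m g = Carmichael m"
    using Carmichael_root_exists[of m] by auto
  have "coprime (int g) (int m)" using g(1) by (simp add: totatives_def)
  then have "[int g ^ (m - 1) = 1] (mod int m)"
    using assms by (simp add: carmichael_number_def)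
  then have "[g ^ (m - 1) = 1] (mod m)"
    by (simp flip: cong_int_iff)
  then show ?thesis using g(2) by (metis ord_divides)
qed

text \<open>For \<open>m > 2\<close> the Carmichael function is even, hence so is
  \<open>m - 1\<close>. Oddness makes the formula for odd prime powers available at every prime
  factor.\<close>

lemma carmichael_number_odd:
  assumes "carmichael_number m"
  shows "odd m"
proof -
  have "m > 2" using assms by (cases "m = 2") (auto simp: carmichael_number_def)
  then have "even (Carmichael m)" by (rule even_Carmichael)
  then have "even (m - 1)" using carmichael_number_Carmichael_dvd[OF assms] by (rule dvd_trans)
  then show ?thesis using \<open>m > 2\<close> by simp
qed

text \<open>If \<open>p ^ k\<close> exactly divides \<open>m\<close>, then
  \<open>p ^ (k - 1) * (p - 1)\<close> divides \<open>m - 1\<close>. Since \<open>p\<close> divides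
  \<open>m\<close>, it cannot divide \<open>m - 1\<close>, which forces
  \<open>k = 1\<close>.\<close>

lemma carmichael_number_korselt:
  assumes "carmichael_number m" "prime p" "p dvd m"
  shows "multiplicity p m = 1" and "p - 1 dvd m - 1"
proof -
  define k where "k = multiplicity p m"
  have "m > 1" using assms(1) by (simp add: carmichael_number_def)
  have "k > 0" unfolding k_def using assms \<open>m > 1\<close> by (simp add: prime_multiplicity_gt_zero_iff)
  obtain n where n: "m = p ^ k * n" "\<not> p dvd n"
    unfolding k_def using multiplicity_decompose'[of m p] assms(2) \<open>m > 1\<close>
    by (metis not_less_zero not_prime_unit)
  have "odd p" using carmichael_number_odd[OF assms(1)] assms(3) by auto
  have "coprime (p ^ k) n" using n(2) assms(2) by (simp add: prime_imp_coprime)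
  then have "Carmichael (p ^ k) dvd Carmichael m"
    by (simp add: n(1) Carmichael_mult_coprime)
  also have "\<dots> dvd m - 1" using assms(1) by (rule carmichael_number_Carmichael_dvd)
  finally have dvd: "p ^ (k - 1) * (p - 1) dvd m - 1"
    using Carmichael_odd_prime_power[OF assms(2) \<open>odd p\<close> \<open>k > 0\<close>] by simp
  then show "p - 1 dvd m - 1" by (rule dvd_mult_right)
  have "\<not> p dvd m - 1"
    using assms(2,3) \<open>m > 1\<close>
    by (metis diff_diff_cancel dvd_diff_nat less_imp_le not_prime_unit)
  then have "\<not> p dvd p ^ (k - 1)" using dvd by (meson dvd_mult_left dvd_trans)
  then have "k - 1 = 0" by (metis dvd_power neq0_conv)
  then have "k = 1" using \<open>k > 0\<close> by simp
  then show "multiplicity p m = 1" by (simp add: k_def)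
qed

text \<open>This turns a count of distinct primes into a factorization: three prime factors mean
  \<open>m = p * q * r\<close>.\<close>

lemma carmichael_number_prod_prime_factors:
  assumes "carmichael_number m"
  shows "m = \<Prod>(prime_factors m)"
proof -
  have "m > 0" using assms by (simp add: carmichael_number_def)
  then have "m = (\<Prod>p\<in>prime_factors m. p ^ multiplicity p m)"
    using prime_factorization_nat by blast
  also have "\<dots> = \<Prod>(prime_factors m)"
    using carmichael_number_korselt(1)[OF assms] by (intro prod.cong) (auto simp: in_prime_factors_iff)
  finally show ?thesis .
qed

text \<open>Multiplying by the base shifts the digits of \<open>n\<close> up one place; the new
  lowest digit 0 leaves their sum unchanged.\<close>

lemma digit_sum_mult_base:
  fixes r n :: nat
  assumes "r \<ge> 2" "n < r\<^sup>2"
  shows "digit_sum r (r * n) = n mod r + n div r"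
proof -
  define a b where "a = n mod r" and "b = n div r"
  define d where "d i = [0, a, b] ! i" for i
  have "b < r" using assms by (simp add: b_def power2_eq_square less_mult_imp_div_less)
  moreover have "a < r" using assms(1) by (simp add: a_def)
  ultimately have "d i < r" if "i < 3" for i
    using that by (auto simp: d_def less_Suc_eq numeral_3_eq_3)
  then have "digit_sum r (\<Sum>i<3. d i * r ^ i) = (\<Sum>i<3. d i)"
    using assms(1) by (rule digit_sum_expansion)
  moreover have "(\<Sum>i<3. d i * r ^ i) = r * (a + b * r)"
    by (simp add: d_def numeral_3_eq_3 algebra_simps)
  moreover have "a + b * r = n" by (simp add: a_def b_def)
  moreover have "(\<Sum>i<3. d i) = a + b"
    by (simp add: d_def numeral_3_eq_3)
  ultimately show ?thesis by (simp add: a_def b_def)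
qed

lemma carmichael_number_digit_sum:
  assumes "carmichael_number (r * n)" "prime r" "1 < n" "n \<noteq> r" "n < r\<^sup>2"
  shows "digit_sum r (r * n) = r"
proof -
  define a b where "a = n mod r" and "b = n div r"
  have "r \<ge> 2" using assms(2) by (rule prime_ge_2_nat)
  have n: "n = a + b * r" by (simp add: a_def b_def)
  have "a < r" using \<open>r \<ge> 2\<close> by (simp add: a_def)
  have "b < r" using assms(5) by (simp add: b_def power2_eq_square less_mult_imp_div_less)
  have "r - 1 dvd r * n - 1"
    using assms(1,2) by (intro carmichael_number_korselt(2)) auto
  moreover have "a + b > 1"
  proof (rule ccontr)
    assume "\<not> a + b > 1"
    then have "(a = 0 \<and> b = 0) \<or> (a = 1 \<and> b = 0) \<or> (a = 0 \<and> b = 1)" by auto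
    then show False using assms(3,4) n by auto
  qed
  \<comment> \<open>Combine \<open>r * n = (r - 1) * n + n\<close> with
    \<open>n = (r - 1) * b + (a + b)\<close>; \<open>a + b > 1\<close> keeps the subtraction from
    truncating.\<close>
  moreover have "r * n - 1 = (r - 1) * (n + b) + (a + b - 1)"
    using \<open>r \<ge> 2\<close> \<open>a + b > 1\<close> n by (cases r) (auto simp: algebra_simps)
  ultimately have "r - 1 dvd a + b - 1"
    by (metis dvd_add_right_iff dvd_triv_left)
  then obtain t where t: "a + b - 1 = (r - 1) * t" ..
  have "t > 0" using t \<open>a + b > 1\<close> by (cases t) auto
  \<comment> \<open>Otherwise \<open>a + b \<ge> 2 * r - 1\<close>, one more than two
    base-\<open>r\<close> digits can add up to.\<close>
  moreover have "t < 2"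
  proof (rule ccontr)
    assume "\<not> t < 2"
    then have "(r - 1) * 2 \<le> (r - 1) * t" by (intro mult_left_mono) auto
    then show False using t \<open>a < r\<close> \<open>b < r\<close> \<open>a + b > 1\<close> by linarith
  qed
  ultimately have "t = 1" by simp
  then have "a + b = r" using t \<open>a + b > 1\<close> \<open>r \<ge> 2\<close> by simp
  then show ?thesis
    using digit_sum_mult_base[OF \<open>r \<ge> 2\<close> assms(5)] by (simp add: a_def b_def)
qed

theorem theorem3p1:
  shows "exceptional_carmichael3 = {}"
proof (rule equals0I)
  fix m assume "m \<in> exceptional_carmichael3"
  then have m: "carmichael_number m" and card: "card (prime_factors m) = 3"
    and exc: "\<And>p. prime p \<Longrightarrow> p dvd m \<Longrightarrow> digit_sum p m \<noteq> p"
    by (auto simp: exceptional_carmichael3_def exceptional_carmichael_def)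
  define r where "r = Max (prime_factors m)"
  have r: "r \<in> prime_factors m" unfolding r_def using card by (intro Max_in) auto
  have "card (prime_factors m - {r}) = 2" using r card by simp
  then obtain p q where pq: "prime_factors m - {r} = {p, q}" "p \<noteq> q"
    by (auto simp: card_2_iff)
  have less: "x < r" if "x \<in> {p, q}" for x
  proof -
    have "x \<in> prime_factors m" "x \<noteq> r" using that pq by auto
    then show ?thesis unfolding r_def by (metis Max_ge finite_set_mset le_neq_implies_less)
  qed
  have prime: "prime p" "prime q" "prime r" using pq r by auto
  have "m = r * \<Prod>(prime_factors m - {r})"
    using carmichael_number_prod_prime_factors[OF m] r
    by (subst (asm) prod.remove[of _ r]) auto
  then have eq: "m = r * (p * q)" using pq by simp
  \<comment> \<open>A product of two primes is composite, whereas \<open>r\<close> is prime.\<close>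
  have "p * q \<noteq> r" using prime by (metis prime_product not_prime_1)
  moreover have "1 < p * q" using prime by (intro less_1_mult prime_gt_1_nat)
  moreover have "p * q < r\<^sup>2"
    unfolding power2_eq_square using less[of p] less[of q] by (intro mult_strict_mono) auto
  ultimately have "digit_sum r m = r"
    using carmichael_number_digit_sum m prime(3) unfolding eq by blast
  then show False using exc[of r] prime(3) eq by simp
qed

end
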